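(* Let $V$ be a vector space over a field $F$ and let $P, Q \colon V \to V$ be projectors. We have $PQ = QP$ if and only if $$\operatorname{Im} Q = (\operatorname{Im} P \cap \operatorname{Im} Q) \oplus (\operatorname{Ker} P \cap \operatorname{Im} Q)$$ and $$\operatorname{Ker} Q = (\operatorname{Im} P \cap \operatorname{Ker} Q) \oplus (\operatorname{Ker} P \cap \operatorname{Ker} Q).$$
   Context: Vector spaces are arbitrary (possibly infinite-dimensional). A projector on $V$ is a linear map $P\colon V\to V$ with $P^2=P$. $\oplus$ denotes a sum of subspaces that is direct. *)

theory Defs
  imports Complex_Main
begin

definition kernel :: "('v \<Rightarrow> 'w::zero) \<Rightarrow> 'v set"
  where "kernel f = {v. f v = 0}"

context vector_space
begin

definition projector :: "('b \<Rightarrow> 'b) \<Rightarrow> bool"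
  where "projector P \<longleftrightarrow> Vector_Spaces.linear scale scale P \<and> P \<circ> P = P"

text \<open>\<open>is_direct_sum U A B\<close> is the assertion \<open>U = A \<oplus> B\<close>: it says both that the sum of the
  subspaces \<open>A\<close> and \<open>B\<close> is direct and that this sum is \<open>U\<close>.\<close>

definition is_direct_sum :: "'b set \<Rightarrow> 'b set \<Rightarrow> 'b set \<Rightarrow> bool"
  where "is_direct_sum U A B \<longleftrightarrow>
    subspace A \<and> subspace B \<and> A \<inter> B = {0} \<and> U = {a + b | a b. a \<in> A \<and> b \<in> B}"

end

end

theory Submission
  imports Defs
begin

text \<open>A projector \<open>P\<close> leaves a subspace \<open>U\<close> invariant iff \<open>U\<close> splits along \<open>Im P\<close> and \<open>Ker P\<close>,
  because the components of \<open>u\<close> are \<open>P u\<close> and \<open>u - P u\<close>. On the other hand, an operator commutes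
  with a projector \<open>Q\<close> iff it leaves both \<open>Im Q\<close> and \<open>Ker Q\<close> invariant.\<close>

context vector_space
begin

lemma projector_idem:
  assumes "projector P"
  shows "P (P x) = P x"
  using assms by (metis projector_def comp_apply)

text \<open>Idempotence makes every value of \<open>P\<close> a fixed point. Membership in the image
  thus becomes the equation \<open>P x = x\<close>, which the simplifier can use.\<close>

lemma range_projector:
  assumes "projector P"
  shows "range P = {x. P x = x}"
proof
  show "range P \<subseteq> {x. P x = x}"
    using projector_idem[OF assms] by blast
  show "{x. P x = x} \<subseteq> range P"
    by (metis (mono_tags) mem_Collect_eq rangeI subsetI)
qed

lemma projector_module_hom:
  assumes "projector P"
  shows "module_hom scale scale P"
  using assms unfolding projector_def by (simp add: linear_iff_module_hom)

lemma subspace_range_projector: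
  assumes "projector P"
  shows "subspace (range P)"
  using module_hom.subspace_image[OF projector_module_hom[OF assms] subspace_UNIV] .

lemma subspace_kernel_projector:
  assumes "projector P"
  shows "subspace (kernel P)"
  using module_hom.subspace_kernel[OF projector_module_hom[OF assms]] unfolding kernel_def .

text \<open>Keeping \<open>U\<close> an arbitrary subspace lets the equivalence serve for both
  \<open>range Q\<close> and \<open>kernel Q\<close>.\<close>

lemma is_direct_sum_projector_iff:
  assumes P: "projector P" and U: "subspace U"
  shows "is_direct_sum U (range P \<inter> U) (kernel P \<inter> U) \<longleftrightarrow> P ` U \<subseteq> U"
proof
  interpret P: module_hom scale scale P
    by (rule projector_module_hom[OF P])
  assume "is_direct_sum U (range P \<inter> U) (kernel P \<inter> U)"
  then have sum: "U = {a + b |a b. a \<in> range P \<inter> U \<and> b \<in> kernel P \<inter> U}"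
    unfolding is_direct_sum_def by (elim conjE)
  show "P ` U \<subseteq> U"
  proof (rule image_subsetI)
    fix u
    assume "u \<in> U"
    then have "u \<in> {a + b |a b. a \<in> range P \<inter> U \<and> b \<in> kernel P \<inter> U}"
      by (simp only: sum[symmetric])
    then obtain a b where "u = a + b" "a \<in> range P" "a \<in> U" "b \<in> kernel P"
      by blast
    \<comment> \<open>\<open>P\<close> fixes \<open>a\<close> and kills \<open>b\<close>, so
      \<open>P u = a\<close>, which lies in \<open>U\<close>.\<close>
    then show "P u \<in> U"
      by (simp add: P.add range_projector[OF P] kernel_def)
  qed
next
  interpret P: module_hom scale scale P
    by (rule projector_module_hom[OF P])
  assume inv: "P ` U \<subseteq> U"
  have "u \<in> {a + b |a b. a \<in> range P \<inter> U \<and> b \<in> kernel P \<inter> U}" if "u \<in> U" for u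
  proof -
    have "P u \<in> range P \<inter> U"
      using inv that by blast
    moreover have "u - P u \<in> kernel P \<inter> U"
      using inv that by (auto simp: kernel_def P.diff projector_idem[OF P] intro: subspace_diff[OF U])
    moreover have "u = P u + (u - P u)"
      by simp
    ultimately show ?thesis
      by blast
  qed
  then have "U = {a + b |a b. a \<in> range P \<inter> U \<and> b \<in> kernel P \<inter> U}"
    using subspace_add[OF U] by blast
  \<comment> \<open>A common vector \<open>x\<close> satisfies \<open>x = P x = 0\<close>.\<close>
  moreover have "(range P \<inter> U) \<inter> (kernel P \<inter> U) = {0}"
    using subspace_0[OF U] P.zero by (auto simp: range_projector[OF P] kernel_def)
  ultimately show "is_direct_sum U (range P \<inter> U) (kernel P \<inter> U)"
    unfolding is_direct_sum_def
    using subspace_inter[OF subspace_range_projector[OF P] U]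
      subspace_inter[OF subspace_kernel_projector[OF P] U] by (intro conjI)
qed

text \<open>Each \<open>x\<close> is \<open>Q x + (x - Q x)\<close>, with parts in
  \<open>range Q\<close> and \<open>kernel Q\<close>. If \<open>T\<close> preserves both subspaces,
  then \<open>T \<circ> Q\<close> and \<open>Q \<circ> T\<close> both act as \<open>T\<close> on the
  first part and as zero on the second. Conversely, commuting gives
  \<open>T (Q x) = Q (T x)\<close>, from which both inclusions follow.\<close>

lemma commute_projector_iff:
  assumes T: "module_hom scale scale T" and Q: "projector Q"
  shows "T \<circ> Q = Q \<circ> T \<longleftrightarrow> T ` range Q \<subseteq> range Q \<and> T ` kernel Q \<subseteq> kernel Q"
proof
  interpret T: module_hom scale scale T
    by (rule T)
  assume "T \<circ> Q = Q \<circ> T"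
  then have comm: "T (Q x) = Q (T x)" for x
    by (metis comp_apply)
  have "Q (T x) = 0" if "Q x = 0" for x
    using comm[of x] that T.zero by simp
  then show "T ` range Q \<subseteq> range Q \<and> T ` kernel Q \<subseteq> kernel Q"
    by (auto simp: comm kernel_def)
next
  interpret T: module_hom scale scale T
    by (rule T)
  interpret Q: module_hom scale scale Q
    by (rule projector_module_hom[OF Q])
  assume inv: "T ` range Q \<subseteq> range Q \<and> T ` kernel Q \<subseteq> kernel Q"
  show "T \<circ> Q = Q \<circ> T"
  proof
    fix x
    have "x - Q x \<in> kernel Q"
      by (simp add: kernel_def Q.diff projector_idem[OF Q])
    then have "Q (T (x - Q x)) = 0"
      using inv unfolding kernel_def by blast
    \<comment> \<open>\<open>T (Q x)\<close> lies in \<open>range Q\<close>, hence is fixed by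
      \<open>Q\<close>. Expanding the previous equation by linearity gives
      \<open>Q (T x) = Q (T (Q x))\<close>, and the two combine.\<close>
    moreover have "Q (T (Q x)) = T (Q x)"
      using inv range_projector[OF Q] by blast
    ultimately show "(T \<circ> Q) x = (Q \<circ> T) x"
      by (simp add: T.diff Q.diff)
  qed
qed

end

theorem corollary9:
  fixes scale :: "'f::field \<Rightarrow> 'v::ab_group_add \<Rightarrow> 'v"
    and P Q :: "'v \<Rightarrow> 'v"
  assumes "vector_space scale"
    and "vector_space.projector scale P"
    and "vector_space.projector scale Q"
  shows "P \<circ> Q = Q \<circ> P \<longleftrightarrow>
      vector_space.is_direct_sum scale (range Q) (range P \<inter> range Q) (kernel P \<inter> range Q) \<and>
      vector_space.is_direct_sum scale (kernel Q) (range P \<inter> kernel Q) (kernel P \<inter> kernel Q)"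
proof -
  interpret vector_space scale
    by (rule assms(1))
  \<comment> \<open>Take \<open>T = P\<close> in the commutation criterion, then translate each
    invariance into a splitting, with \<open>U = range Q\<close> and
    \<open>U = kernel Q\<close>.\<close>
  show ?thesis
    using commute_projector_iff[OF projector_module_hom[OF assms(2)] assms(3)]
      is_direct_sum_projector_iff[OF assms(2) subspace_range_projector[OF assms(3)]]
      is_direct_sum_projector_iff[OF assms(2) subspace_kernel_projector[OF assms(3)]]
    by simp
qed

end
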